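(* Suppose the linear equation $\mathbf{z}=\mathbf{H}\mathbf{y}$ has a unique solution $\mathbf{x}^*$, and for some $p\in(0,1)$ the $p$-persistent graph $\mathcal{G}_P(p)$ of the random graph process $\langle\mathcal{G}\rangle$ is connected. Let $\mathbf{x}_i(t)$, $i\in\mathrm{V}$, be generated from fixed initial states by the distributed randomized projection consensus algorithm $$\mathbf{x}_i(t+1)=\Pi_{\mathcal{A}_i^{s_i(t)}}\Big(\sum_{j=1}^N\mathbf{W}_{ij}(t)\mathbf{x}_j(t)\Big),\qquad i=1,\dots,N,\ t=0,1,2,\dots.$$ Then all local estimates $\mathbf{x}_i(t)$, $i\in\mathrm{V}$, converge almost surely to $\mathbf{x}^*$. Moreover, the error converges to zero at an exponential rate in the mean-squared sense: there exist constants $0<\mu_2<1$ and $c_2>0$ such that $$\mathbb{E}\Big[\sum_{i\in\mathrm{V}}\|\mathbf{x}_i(t)-\mathbf{x}^*\|^2\Big]\le c_2\mu_2^{t}\qquad\text{for all } t\ge0.$$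
   Context: Linear equation: $\mathbf{H}\in\mathbb{R}^{l\times m}$, $\mathbf{z}\in\mathbb{R}^l$, unknown $\mathbf{y}\in\mathbb{R}^m$. The rows are partitioned into $N$ consecutive blocks; node $i\in\mathrm{V}=\{1,\dots,N\}$ holds $\mathbf{z}_i=\mathbf{H}_i\mathbf{y}$, $\mathbf{H}_i\in\mathbb{R}^{l_i\times m}$, $\sum_i l_i=l$. The rows of $\mathbf{H}_i$ are $\mathbf{H}_i^{(1)},\dots,\mathbf{H}_i^{(l_i)}$ and the entries of $\mathbf{z}_i$ are $\mathbf{z}_i^{(1)},\dots,\mathbf{z}_i^{(l_i)}$. Randomized row selection: at each time $t$, node $i$ selects $s_i(t)\in\{1,\dots,l_i\}$ at random with $\mathbb{P}(s_i(t)=s)=\|\mathbf{H}_i^{(s)}\|^2/\|\mathbf{H}_i\|_F^2$ (each $\mathbf{H}_i\neq\mathbf 0$, so that this is well defined), independently over time, across nodes, and independently of the random graph process. Put $\mathcal{A}_i^{s_i(t)}=\{\mathbf{y}\in\mathbb{R}^m:\mathbf{z}_i^{(s_i(t))}=\mathbf{H}_i^{(s_i(t))}\mathbf{y}\}$. $\Pi_\Omega$ is Euclidean projection onto a closed convex set $\Omega$; $\|\cdot\|$ is the Euclidean norm and $\|\cdot\|_F$ the Frobenius norm. Random graphs: $\langle\mathcal{G}\rangle$ is a random process of undirected graphs $\mathcal{G}(t)=\{\mathrm{V},\mathcal{E}(t)\}$, $t=0,1,2,\dots$ (edges are unordered pairs of distinct nodes). Let $\mathcal{I}_{ij}(t)=1$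 if $\{i,j\}\in\mathcal{E}(t)$ and $0$ otherwise, and $\mathcal{I}(t)=(\mathcal{I}_{ij}(t))_{i,j\in\mathrm{V}}$. Standing assumption: $\langle\mathcal{I}(t)\rangle_{t\ge0}$ is $\ast$-mixing, i.e. there is a non-increasing sequence of real numbers $\lambda_t$, $t=0,1,\dots$, with $\lim_{t\to\infty}\lambda_t=0$, such that for all $m,s=0,1,2,\dots$, all $\mathsf{A}\in\mathcal{F}_0^m$ and all $\mathsf{B}\in\mathcal{F}_{m+s}^\infty$, $|\mathbb{P}(\mathsf{A}\cap\mathsf{B})-\mathbb{P}(\mathsf{A})\mathbb{P}(\mathsf{B})|\le\lambda_s\mathbb{P}(\mathsf{A})\mathbb{P}(\mathsf{B})$, where $\mathcal{F}_l^k$ is the $\sigma$-algebra generated by $\mathcal{I}(l),\dots,\mathcal{I}(k)$ (with $k=\infty$ allowed). Persistent graph: for $p\in(0,1)$, $\mathcal{G}_P(p)=(\mathrm{V},\mathcal{E}_P(p))$ with $\mathcal{E}_P(p)=\{\{i,j\}:\mathbb{P}(\{i,j\}\in\mathcal{E}(t))\ge p\ \forall t\ge0\}$. Mixing weights: for all $t$, $\mathbf{W}(t)\in\mathbb{R}^{N\times N}$ is $\mathcal{G}(t)$-measurable; there is $0<\eta<1$ (independent of $t$) with $\mathbf{W}_{ii}(t)\ge\eta$ for all $i$, $\mathbf{W}_{ij}(t)=\mathbf{W}_{ji}(t)\ge\eta$ if $\{i,j\}\in\mathcal{E}(t)$, and $\mathbf{W}_{ij}(t)=\mathbf{W}_{ji}(t)=0$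 for $i\ne j$ otherwise; and $\mathbf{W}(t)\mathbf{1}_N=\mathbf{1}_N$, $\mathbf{1}_N^T\mathbf{W}(t)=\mathbf{1}_N^T$. *)

theory Defs
  imports "HOL-Probability.Probability"
begin

text \<open>
  The row indices form a finite linear order, and \<open>owner r\<close> is the node holding row \<open>r\<close>. When
  \<open>owner\<close> is monotone, the blocks are runs of consecutive rows.
\<close>

definition block_rows :: "('l \<Rightarrow> 'n) \<Rightarrow> 'n \<Rightarrow> 'l set" where
  "block_rows owner i = {r. owner r = i}"

definition block_frobenius :: "real^'m^'l \<Rightarrow> ('l \<Rightarrow> 'n) \<Rightarrow> 'n \<Rightarrow> real" where
  "block_frobenius H owner i = sqrt (\<Sum>r\<in>block_rows owner i. \<Sum>k\<in>UNIV. (H $ r $ k)\<^sup>2)"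

definition row_solutions :: "real^'m^'l \<Rightarrow> real^'l \<Rightarrow> 'l \<Rightarrow> (real^'m) set" where
  "row_solutions H z r = {y. z $ r = row r H \<bullet> y}"

definition all_edges :: "'n set set" where
  "all_edges = {{i, j} | i j. i \<noteq> j}"

definition graph_connected :: "'n set set \<Rightarrow> bool" where
  "graph_connected E \<longleftrightarrow> (\<forall>i j. (i, j) \<in> {(a, b). {a, b} \<in> E}\<^sup>*)"

definition link_matrix :: "'n set set \<Rightarrow> real^'n^'n" where
  "link_matrix E = (\<chi> i j. if {i, j} \<in> E then 1 else 0)"

definition persistent_edges ::
    "'w measure \<Rightarrow> (nat \<Rightarrow> 'w \<Rightarrow> 'n set set) \<Rightarrow> real \<Rightarrow> 'n set set" where
  "persistent_edges M E p =
     {{i, j} | i j. i \<noteq> j \<and> (\<forall>t. measure M {\<omega> \<in> space M. {i, j} \<in> E t \<omega>} \<ge> p)}"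

definition mixing_weights :: "real \<Rightarrow> 'n set set \<Rightarrow> real^'n^'n \<Rightarrow> bool" where
  "mixing_weights \<eta> E W \<longleftrightarrow>
     (\<forall>i. W $ i $ i \<ge> \<eta>) \<and>
     (\<forall>i j. i \<noteq> j \<longrightarrow> W $ i $ j = W $ j $ i) \<and>
     (\<forall>i j. {i, j} \<in> E \<longrightarrow> i \<noteq> j \<longrightarrow> W $ i $ j \<ge> \<eta>) \<and>
     (\<forall>i j. {i, j} \<notin> E \<longrightarrow> i \<noteq> j \<longrightarrow> W $ i $ j = 0) \<and>
     W *v 1 = 1 \<and> 1 v* W = 1"

definition generated_events ::
    "'w measure \<Rightarrow> 'b measure \<Rightarrow> ('k \<Rightarrow> 'w \<Rightarrow> 'b) \<Rightarrow> 'k set \<Rightarrow> 'w set set" where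
  "generated_events M N X K =
     sigma_sets (space M) {X k -` A \<inter> space M | k A. k \<in> K \<and> A \<in> sets N}"

definition star_mixing ::
    "'w measure \<Rightarrow> 'b measure \<Rightarrow> (nat \<Rightarrow> 'w \<Rightarrow> 'b) \<Rightarrow> bool" where
  "star_mixing M N X \<longleftrightarrow>
     (\<exists>lam :: nat \<Rightarrow> real. decseq lam \<and> lam \<longlonglongrightarrow> 0 \<and>
       (\<forall>m s. \<forall>A \<in> generated_events M N X {0..m}. \<forall>B \<in> generated_events M N X {m + s..}.
          \<bar>measure M (A \<inter> B) - measure M A * measure M B\<bar> \<le> lam s * measure M A * measure M B))"

end

theory Submission
  imports Defs
begin

text \<open>
  The total squared error \<open>V\<close> never increases: averaging with doubly stochastic weights and
  projecting onto hyperplanes through \<open>xstar\<close> are both contractions. A step that loses little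
  moves every estimate only little. So if little is lost over a window in which every persistent
  edge and every nonzero row is used, then the estimates nearly agree and nearly solve every row;
  hence such a window shrinks \<open>V\<close> by a fixed factor, whatever else happens in it. Conditionally on
  the history, a window is of this kind with probability bounded below: \<open>*\<close>-mixing lets the persistent edges be collected one
  at a time, separated by a gap at which the mixing coefficient is below \<open>1/2\<close>, and the row
  selections are independent. Hence the expectation of \<open>V\<close> decays geometrically over windows,
  and almost sure convergence follows since \<open>V\<close> is monotone.
\<close>

section \<open>Contraction over a window\<close>

text \<open>Expanding each square around \<open>c\<close>, the cross terms collapse because the
  weights sum to one. With \<open>c\<close> the solution, the left side is exactly what averaging
  removes from the weighted squared error.\<close>

lemma weighted_variance:
  fixes e :: "'a \<Rightarrow> 'b::real_inner"
  assumes "finite A" "(\<Sum>j\<in>A. w j) = 1"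
  defines "y \<equiv> \<Sum>j\<in>A. w j *\<^sub>R e j"
  shows "(\<Sum>j\<in>A. w j * (norm (e j - y))\<^sup>2) = (\<Sum>j\<in>A. w j * (norm (e j - c))\<^sup>2) - (norm (y - c))\<^sup>2"
proof -
  have "w j * (norm (e j - y))\<^sup>2 =
      w j * (norm (e j - c))\<^sup>2 - 2 * ((w j *\<^sub>R e j - w j *\<^sub>R c) \<bullet> (y - c)) + w j * (norm (y - c))\<^sup>2" for j
    by (simp add: power2_norm_eq_inner inner_diff inner_commute algebra_simps)
  then have "(\<Sum>j\<in>A. w j * (norm (e j - y))\<^sup>2) =
      (\<Sum>j\<in>A. w j * (norm (e j - c))\<^sup>2)
      - 2 * ((\<Sum>j\<in>A. w j *\<^sub>R e j - w j *\<^sub>R c) \<bullet> (y - c)) + (\<Sum>j\<in>A. w j) * (norm (y - c))\<^sup>2"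
    by (simp add: sum.distrib sum_subtractf sum_distrib_left sum_distrib_right inner_sum_left
        inner_diff_left right_diff_distrib)
  also have "(\<Sum>j\<in>A. w j *\<^sub>R e j - w j *\<^sub>R c) = y - c"
    using assms(2) by (simp add: sum_subtractf y_def flip: scaleR_left.sum)
  finally show ?thesis using assms(2) by (simp add: power2_norm_eq_inner)
qed

text \<open>The angle at the projection is not acute. The first square is the guaranteed loss of a
  projection step.\<close>

lemma closest_point_pythagoras:
  fixes S :: "'a::euclidean_space set"
  assumes "convex S" "closed S" "c \<in> S"
  shows "(norm (y - closest_point S y))\<^sup>2 + (norm (closest_point S y - c))\<^sup>2 \<le> (norm (y - c))\<^sup>2"
  using closest_point_dot[OF assms, of y]
  by (simp add: power2_norm_eq_inner inner_diff inner_commute algebra_simps)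

lemma row_solutions_convex_closed: "convex (row_solutions H z r)" "closed (row_solutions H z r)"
proof -
  have "row_solutions H z r = {y. row r H \<bullet> y = z $ r}" by (auto simp: row_solutions_def)
  then show "convex (row_solutions H z r)" "closed (row_solutions H z r)"
    by (simp_all add: convex_hyperplane closed_hyperplane)
qed

lemma mem_row_solutions: "H *v y = z \<Longrightarrow> y \<in> row_solutions H z r"
  by (auto simp: row_solutions_def matrix_vector_mult_def row_def inner_vec_def)

lemma mixing_weightsD:
  assumes "mixing_weights \<eta> E W" "0 < \<eta>"
  shows "W $ i $ j \<ge> 0" "(\<Sum>j\<in>UNIV. W $ i $ j) = 1" "(\<Sum>i\<in>UNIV. W $ i $ j) = 1"
    "W $ i $ i \<ge> \<eta>" "{i, j} \<in> E \<Longrightarrow> W $ i $ j \<ge> \<eta>"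
proof -
  show "W $ i $ i \<ge> \<eta>" "{i, j} \<in> E \<Longrightarrow> W $ i $ j \<ge> \<eta>"
    using assms by (auto simp: mixing_weights_def) (cases "i = j"; auto)
  show "W $ i $ j \<ge> 0"
    using assms unfolding mixing_weights_def
    by (metis less_eq_real_def order.trans)
  have "(W *v 1) $ i = 1" "(1 v* W) $ j = 1" using assms by (simp_all add: mixing_weights_def)
  then show "(\<Sum>j\<in>UNIV. W $ i $ j) = 1" "(\<Sum>i\<in>UNIV. W $ i $ j) = 1"
    by (simp_all add: matrix_vector_mult_def vector_matrix_mult_def)
qed

definition sq_error :: "'a::real_normed_vector \<Rightarrow> ('n::finite \<Rightarrow> 'a) \<Rightarrow> real" where
  "sq_error c e = (\<Sum>i\<in>UNIV. (norm (e i - c))\<^sup>2)"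

lemma sq_error_nonneg [simp]: "0 \<le> sq_error c e"
  by (simp add: sq_error_def sum_nonneg)

text \<open>At each node the losses of averaging and of projection add up. In the sum over all
  nodes, the column sums of \<open>W\<close> turn the weighted squared errors back into
  \<open>sq_error c e\<close>; the row sums make each \<open>y i\<close> a weighted mean.\<close>

lemma projection_consensus_step_loss:
  fixes e :: "'n::finite \<Rightarrow> 'a::euclidean_space" and W :: "real^'n^'n"
  assumes W: "mixing_weights \<eta> E W" "0 < \<eta>"
    and S: "\<And>i. convex (S i)" "\<And>i. closed (S i)" "\<And>i. c \<in> S i"
  defines "y \<equiv> \<lambda>i. \<Sum>j\<in>UNIV. W $ i $ j *\<^sub>R e j"
  defines "e' \<equiv> \<lambda>i. closest_point (S i) (y i)"
  shows "(\<Sum>i\<in>UNIV. (\<Sum>j\<in>UNIV. W $ i $ j * (norm (e j - y i))\<^sup>2) + (norm (y i - e' i))\<^sup>2)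
    \<le> sq_error c e - sq_error c e'"
proof -
  have "(\<Sum>j\<in>UNIV. W $ i $ j * (norm (e j - y i))\<^sup>2) + (norm (y i - e' i))\<^sup>2
     \<le> (\<Sum>j\<in>UNIV. W $ i $ j * (norm (e j - c))\<^sup>2) - (norm (e' i - c))\<^sup>2" for i
    using weighted_variance[of UNIV "\<lambda>j. W $ i $ j" e c] mixing_weightsD(2)[OF W, of i]
      closest_point_pythagoras[OF S(1)[of i] S(2)[of i] S(3)[of i], of "y i"]
    by (simp add: y_def e'_def)
  then have "(\<Sum>i\<in>UNIV. (\<Sum>j\<in>UNIV. W $ i $ j * (norm (e j - y i))\<^sup>2) + (norm (y i - e' i))\<^sup>2)
    \<le> (\<Sum>i\<in>UNIV. (\<Sum>j\<in>UNIV. W $ i $ j * (norm (e j - c))\<^sup>2)) - sq_error c e'"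
    unfolding sq_error_def sum_subtractf[symmetric] by (intro sum_mono)
  also have "(\<Sum>i\<in>UNIV. (\<Sum>j\<in>UNIV. W $ i $ j * (norm (e j - c))\<^sup>2)) = sq_error c e"
    unfolding sq_error_def
    by (subst sum.swap) (simp add: mixing_weightsD(3)[OF W] flip: sum_distrib_right)
  finally show ?thesis .
qed

text \<open>All summands of the loss are nonnegative, so each alone is at most the decrease
  \<open>D\<close>. Weights of size at least \<open>\<eta>\<close> on the diagonal and on edges then
  put the corresponding states within \<open>sqrt (D / \<eta>)\<close> of the mean
  \<open>y i\<close>, and so does the projection since \<open>\<eta> < 1\<close>. The factor 2 in
  \<open>b\<close> is the triangle inequality through \<open>y i\<close>.\<close>

lemma projection_consensus_step:
  fixes e :: "'n::finite \<Rightarrow> 'a::euclidean_space" and W :: "real^'n^'n"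
  assumes W: "mixing_weights \<eta> E W" "0 < \<eta>" "\<eta> < 1"
    and S: "\<And>i. convex (S i)" "\<And>i. closed (S i)" "\<And>i. c \<in> S i"
    and e': "\<And>i. e' i = closest_point (S i) (\<Sum>j\<in>UNIV. W $ i $ j *\<^sub>R e j)"
  defines "b \<equiv> 2 * sqrt ((sq_error c e - sq_error c e') / \<eta>)"
  shows "sq_error c e' \<le> sq_error c e"
    and "norm (e' i - e i) \<le> b"
    and "{i, j} \<in> E \<Longrightarrow> norm (e i - e j) \<le> b"
proof -
  define y where "y = (\<lambda>i. \<Sum>j\<in>UNIV. W $ i $ j *\<^sub>R e j)"
  define D where "D = sq_error c e - sq_error c e'"
  have pos: "W $ i $ j * (norm (e j - y i))\<^sup>2 \<ge> 0" for i j
    using mixing_weightsD(1)[OF W(1,2)] by simp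
  have e'y: "e' = (\<lambda>i. closest_point (S i) (y i))" by (auto simp: e' y_def)
  have loss: "(\<Sum>i\<in>UNIV. (\<Sum>j\<in>UNIV. W $ i $ j * (norm (e j - y i))\<^sup>2) + (norm (y i - e' i))\<^sup>2) \<le> D"
    using projection_consensus_step_loss[OF W(1,2) S, of e] unfolding D_def e'y y_def by simp
  moreover have "0 \<le> (\<Sum>i\<in>UNIV. (\<Sum>j\<in>UNIV. W $ i $ j * (norm (e j - y i))\<^sup>2) + (norm (y i - e' i))\<^sup>2)"
    by (intro sum_nonneg add_nonneg_nonneg pos) auto
  ultimately show "sq_error c e' \<le> sq_error c e" unfolding D_def by linarith
  then have D0: "D \<ge> 0" by (simp add: D_def)
  have lossi: "(\<Sum>j\<in>UNIV. W $ i $ j * (norm (e j - y i))\<^sup>2) + (norm (y i - e' i))\<^sup>2 \<le> D" for i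
    by (rule order.trans[OF member_le_sum loss]) (auto intro!: add_nonneg_nonneg sum_nonneg pos)
  have lossij: "W $ i $ j * (norm (e j - y i))\<^sup>2 \<le> D" for i j
    using member_le_sum[of j UNIV "\<lambda>j. W $ i $ j * (norm (e j - y i))\<^sup>2"] pos lossi[of i]
    by (smt (verit) UNIV_I finite zero_le_power2)
  have near: "norm (e j - y i) \<le> sqrt (D / \<eta>)" if "W $ i $ j \<ge> \<eta>" for i j
  proof (rule real_le_rsqrt)
    have "\<eta> * (norm (e j - y i))\<^sup>2 \<le> D"
      using lossij[of i j] mult_right_mono[OF that, of "(norm (e j - y i))\<^sup>2"] by simp
    then show "(norm (e j - y i))\<^sup>2 \<le> D / \<eta>" using W(2) by (simp add: field_simps)
  qed
  have proj: "norm (y i - e' i) \<le> sqrt (D / \<eta>)" for i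
  proof (rule real_le_rsqrt)
    have "(norm (y i - e' i))\<^sup>2 \<le> D"
      using lossi[of i] sum_nonneg[of UNIV "\<lambda>j. W $ i $ j * (norm (e j - y i))\<^sup>2"] pos by (smt (verit))
    also have "D \<le> D / \<eta>" using D0 W(2,3) by (simp add: field_simps mult_left_le)
    finally show "(norm (y i - e' i))\<^sup>2 \<le> D / \<eta>" .
  qed
  have b: "b = sqrt (D / \<eta>) + sqrt (D / \<eta>)" by (simp add: b_def D_def)
  show "norm (e' i - e i) \<le> b"
    using norm_triangle_le_diff[of "y i - e i" "y i - e' i" b] norm_triangle_ineq4[of "e i - y i" "e' i - y i"]
      near[of i i] mixing_weightsD(4)[OF W(1,2)] proj[of i]
    by (simp add: b norm_minus_commute)
  show "norm (e i - e j) \<le> b" if "{i, j} \<in> E"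
    using norm_triangle_ineq4[of "e i - y i" "e j - y i"]
      near[of i i] near[of i j] mixing_weightsD(4,5)[OF W(1,2)] that
    by (smt (verit) b diff_diff_eq2 diff_add_cancel)
qed

text \<open>The triangle inequality is applied along a walk. Summing the walk lengths over all pairs
  gives one constant that depends on the graph only and serves every \<open>f\<close> and
  \<open>b\<close>.\<close>

lemma graph_connected_norm_bound:
  fixes P :: "'n::finite set set"
  assumes "graph_connected P"
  obtains C :: real where "0 \<le> C"
    "\<And>(f :: 'n \<Rightarrow> 'a::real_normed_vector) b i j.
       0 \<le> b \<Longrightarrow> (\<And>i j. {i, j} \<in> P \<Longrightarrow> norm (f i - f j) \<le> b) \<Longrightarrow> norm (f i - f j) \<le> C * b"
proof -
  have "\<exists>n. (i, j) \<in> {(a, b). {a, b} \<in> P} ^^ n" for i j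
    using assms rtrancl_imp_relpow unfolding graph_connected_def by fastforce
  then obtain n where n: "\<And>i j. (i, j) \<in> {(a, b). {a, b} \<in> P} ^^ n i j" by metis
  define C where "C = (\<Sum>i\<in>UNIV. \<Sum>j\<in>UNIV. real (n i j))"
  have bound: "norm (f i - f j) \<le> C * b"
    if b: "0 \<le> b" "\<And>i j. {i, j} \<in> P \<Longrightarrow> norm (f i - f j) \<le> b" for f :: "'n \<Rightarrow> 'a" and b i j
  proof -
    have walk: "norm (f i - f j) \<le> real k * b" if "(i, j) \<in> {(a, b). {a, b} \<in> P} ^^ k" for k j
      using that
    proof (induction k arbitrary: j)
      case (Suc k)
      then obtain l where "norm (f i - f l) \<le> real k * b" "{l, j} \<in> P" by auto
      then show ?case
        using b(2)[of l j] norm_triangle_ineq[of "f i - f l" "f l - f j"] by (simp add: algebra_simps)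
    qed auto
    have "real (n i j) \<le> (\<Sum>j\<in>UNIV. real (n i j))" by (rule member_le_sum) auto
    also have "\<dots> \<le> C" unfolding C_def by (rule member_le_sum) (auto intro: sum_nonneg)
    finally have "real (n i j) * b \<le> C * b" using b(1) by (rule mult_right_mono)
    then show ?thesis using walk[OF n, of j] by linarith
  qed
  show thesis by (rule that[OF _ bound]) (auto simp: C_def intro!: sum_nonneg)
qed

text \<open>Uniqueness makes the kernel of \<open>H\<close> trivial, so \<open>H\<close> is bounded
  below on vectors. The residual of \<open>v\<close> in a row is at most the norm of that row times
  \<open>a\<close> by Cauchy-Schwarz, and vanishes for zero rows; the sum \<open>R\<close> of the
  row norms then bounds the whole residual.\<close>

lemma unique_solution_norm_bound:
  fixes H :: "real^'m::finite^'l::finite"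
  assumes "H *v c = z" "\<And>y. H *v y = z \<Longrightarrow> y = c"
  obtains B :: real where "0 \<le> B" "\<And>v a. 0 \<le> a \<Longrightarrow>
      (\<And>r. row r H \<noteq> 0 \<Longrightarrow> \<exists>u \<in> row_solutions H z r. norm (v - u) \<le> a) \<Longrightarrow> norm (v - c) \<le> B * a"
proof -
  have "inj ((*v) H)"
    unfolding linear_injective_0[OF matrix_vector_mul_linear]
  proof (intro allI impI)
    fix v assume "H *v v = 0"
    then have "H *v (c + v) = z" using assms(1) by (simp add: matrix_vector_right_distrib)
    from assms(2)[OF this] show "v = 0" by simp
  qed
  then obtain B where B: "B > 0" "\<And>v. B * norm v \<le> norm (H *v v)"
    using linear_inj_bounded_below_pos[OF matrix_vector_mul_linear] by blast
  define R where "R = (\<Sum>r\<in>UNIV. norm (row r H))"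
  show thesis
  proof (rule that[of "R / B"])
    show "0 \<le> R / B" using B(1) by (simp add: R_def sum_nonneg)
    fix v and a :: real
    assume a: "0 \<le> a" and near: "\<And>r. row r H \<noteq> 0 \<Longrightarrow> \<exists>u \<in> row_solutions H z r. norm (v - u) \<le> a"
    have comp: "(H *v (v - c)) $ r = row r H \<bullet> (v - c)" for r
      by (simp add: matrix_vector_mult_def row_def inner_vec_def)
    have "\<bar>(H *v (v - c)) $ r\<bar> \<le> norm (row r H) * a" for r
    proof (cases "row r H = 0")
      case False
      then obtain u where u: "u \<in> row_solutions H z r" "norm (v - u) \<le> a" using near by blast
      have "row r H \<bullet> (v - c) = row r H \<bullet> (v - u)"
        using u(1) mem_row_solutions[OF assms(1), of r] by (simp add: row_solutions_def inner_diff_right)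
      then show ?thesis
        using Cauchy_Schwarz_ineq2[of "row r H" "v - u"] u(2)
        by (simp add: comp) (meson mult_left_mono norm_ge_zero order.trans)
    qed (simp add: comp)
    then have "norm (H *v (v - c)) \<le> (\<Sum>r\<in>UNIV. norm (row r H) * a)"
      by (intro order.trans[OF norm_le_l1_cart] sum_mono)
    also have "\<dots> = R * a" by (simp add: R_def sum_distrib_right)
    finally have "B * norm (v - c) \<le> R * a" using B(2)[of "v - c"] by linarith
    then show "norm (v - c) \<le> R / B * a" using B(1) by (simp add: field_simps)
  qed
qed

text \<open>If the squared error drops by \<open>d\<close> over the window, every move and every
  disagreement along an active edge is of order \<open>sqrt d\<close>. Hence the initial states
  nearly agree and nearly satisfy each nonzero row, so the initial squared error is at most
  \<open>Q * d\<close>; solving for the final error gives the factor. The constant is fixed before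
  the trajectory, hence is uniform over outcomes and starting times.\<close>

lemma window_contraction:
  fixes H :: "real^'m::finite^'l::finite" and owner :: "'l \<Rightarrow> 'n::finite" and P :: "'n set set"
  assumes H: "H *v c = z" "\<And>y. H *v y = z \<Longrightarrow> y = c"
    and P: "graph_connected P" and \<eta>: "0 < \<eta>" "\<eta> < 1"
  obtains \<kappa> :: real where "0 < \<kappa>" "\<kappa> \<le> 1"
    "\<And>e E W s.
      (\<And>k. k < T \<Longrightarrow> mixing_weights \<eta> (E k) (W k)) \<Longrightarrow>
      (\<And>k i. k < T \<Longrightarrow> e (Suc k) i =
         closest_point (row_solutions H z (s k i)) (\<Sum>j\<in>UNIV. W k $ i $ j *\<^sub>R e k j)) \<Longrightarrow>
      (\<And>a. a \<in> P \<Longrightarrow> \<exists>k<T. a \<in> E k) \<Longrightarrow>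
      (\<And>r. row r H \<noteq> 0 \<Longrightarrow> \<exists>k<T. s k (owner r) = r) \<Longrightarrow>
      sq_error c (e T) \<le> (1 - \<kappa>) * sq_error c (e 0)"
proof -
  obtain C :: real where C: "0 \<le> C"
    "\<And>(f :: 'n \<Rightarrow> real^'m) b i j.
       0 \<le> b \<Longrightarrow> (\<And>i j. {i, j} \<in> P \<Longrightarrow> norm (f i - f j) \<le> b) \<Longrightarrow> norm (f i - f j) \<le> C * b"
    using graph_connected_norm_bound[OF P] by blast
  obtain B where B: "0 \<le> B" "\<And>v a. 0 \<le> a \<Longrightarrow>
      (\<And>r. row r H \<noteq> 0 \<Longrightarrow> \<exists>u \<in> row_solutions H z r. norm (v - u) \<le> a) \<Longrightarrow> norm (v - c) \<le> B * a"
    using unique_solution_norm_bound[OF H] by blast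
  \<comment> \<open>In units of \<open>b\<close>: states joined by an edge of \<open>P\<close>
    differ initially by at most \<open>2 * T + 1\<close> (two drifts of at most \<open>T\<close>,
    plus 1 when the edge is active), \<open>C\<close> extends this to all pairs, another
    \<open>T\<close> is the drift of the owner until its row is used, and \<open>B\<close> converts
    closeness to the rows into closeness to \<open>c\<close>.\<close>
  define K where "K = B * (C * (2 * T + 1) + T)"
  \<comment> \<open>The factor \<open>4 / \<eta>\<close> comes from squaring \<open>b\<close>, and
    \<open>CARD('n')\<close> from summing over the nodes. The summand 1 gives
    \<open>1 \<le> Q\<close>, so that \<open>1 / Q\<close> is a valid factor.\<close>
  define Q where "Q = 1 + CARD('n) * K\<^sup>2 * 4 / \<eta>"
  have K0: "0 \<le> K" using B(1) C(1) by (simp add: K_def)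
  have Q1: "1 \<le> Q" using \<eta> by (simp add: Q_def)
  show thesis
  proof (rule that[of "1 / Q"])
    show "0 < 1 / Q" "1 / Q \<le> 1" using Q1 by auto
    fix e :: "nat \<Rightarrow> 'n \<Rightarrow> real^'m" and E W and s :: "nat \<Rightarrow> 'n \<Rightarrow> 'l"
    assume W: "\<And>k. k < T \<Longrightarrow> mixing_weights \<eta> (E k) (W k)"
      and e: "\<And>k i. k < T \<Longrightarrow> e (Suc k) i =
         closest_point (row_solutions H z (s k i)) (\<Sum>j\<in>UNIV. W k $ i $ j *\<^sub>R e k j)"
      and edges: "\<And>a. a \<in> P \<Longrightarrow> \<exists>k<T. a \<in> E k"
      and rows: "\<And>r. row r H \<noteq> 0 \<Longrightarrow> \<exists>k<T. s k (owner r) = r"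
    define loss where "loss k = 2 * sqrt ((sq_error c (e k) - sq_error c (e (Suc k))) / \<eta>)" for k
    have step: "sq_error c (e (Suc k)) \<le> sq_error c (e k)" "norm (e (Suc k) i - e k i) \<le> loss k"
      "{i, j} \<in> E k \<Longrightarrow> norm (e k i - e k j) \<le> loss k" if "k < T" for k i j
      unfolding loss_def
      by (rule projection_consensus_step[OF W[OF that] \<eta> row_solutions_convex_closed
            mem_row_solutions[OF H(1)] e[OF that]]; assumption)+
    define d where "d = sq_error c (e 0) - sq_error c (e T)"
    define b where "b = 2 * sqrt (d / \<eta>)"
    have anti: "sq_error c (e l) \<le> sq_error c (e k)" if "k \<le> l" "l \<le> T" for k l
      using that by (induction l rule: dec_induct) (auto intro: order.trans[OF step(1)])
    have d0: "0 \<le> d" using anti[of 0 T] by (simp add: d_def)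
    have b0: "0 \<le> b" using d0 \<eta> by (simp add: b_def)
    \<comment> \<open>By monotonicity no single step loses more than the whole window.\<close>
    have le_b: "loss k \<le> b" if "k < T" for k
      using anti[of 0 k] anti[of "Suc k" T] that \<eta> by (auto simp: loss_def b_def d_def divide_right_mono)
    have move: "norm (e k i - e 0 i) \<le> k * b" if "k \<le> T" for k i
      using that
    proof (induction k)
      case (Suc k)
      have "norm (e (Suc k) i - e k i) \<le> b"
        using step(2)[of k i] le_b[of k] Suc.prems by (auto intro: order.trans)
      then show ?case
        using Suc norm_triangle_ineq[of "e (Suc k) i - e k i" "e k i - e 0 i"]
        by (simp add: algebra_simps)
    qed simp
    have moveT: "norm (e k i - e 0 i) \<le> T * b" if "k \<le> T" for k i
      using move[OF that, of i] that b0 by (meson mult_right_mono of_nat_le_iff order.trans)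
    have edge: "norm (e 0 i - e 0 j) \<le> (2 * T + 1) * b" if ij: "{i, j} \<in> P" for i j
    proof -
      obtain k where k: "k < T" "{i, j} \<in> E k" using edges[OF ij] by blast
      have "norm (e k i - e k j) \<le> b"
        using step(3)[of k i j] k le_b[of k] by (auto intro: order.trans)
      moreover have "norm (e 0 i - e 0 j) \<le> norm (e k i - e k j) + norm (e k i - e 0 i) + norm (e k j - e 0 j)"
        using norm_triangle_ineq[of "(e k i - e k j) - (e k i - e 0 i)" "e k j - e 0 j"]
          norm_triangle_ineq4[of "e k i - e k j" "e k i - e 0 i"] by simp
      ultimately show ?thesis using moveT[of k i] moveT[of k j] k(1) by (simp add: algebra_simps)
    qed
    have agree: "norm (e 0 i - e 0 j) \<le> C * ((2 * T + 1) * b)" for i j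
      by (rule C(2)[OF _ edge]) (use b0 in auto)
    have "norm (e 0 i - c) \<le> B * (C * ((2 * T + 1) * b) + T * b)" for i
    proof (rule B(2))
      show "0 \<le> C * ((2 * T + 1) * b) + T * b" using C(1) b0 by simp
      fix r assume "row r H \<noteq> 0"
      then obtain k where k: "k < T" "s k (owner r) = r" using rows by blast
      \<comment> \<open>The state just after the projection onto row \<open>r\<close> lies on the
        hyperplane of that row; its time \<open>Suc k\<close> is still at most
        \<open>T\<close>.\<close>
      let ?u = "e (Suc k) (owner r)"
      have "?u \<in> row_solutions H z r"
        using closest_point_in_set[OF row_solutions_convex_closed(2), of H z r] k
          mem_row_solutions[OF H(1), of r] by (auto simp: e)
      moreover have "norm (e 0 i - ?u) \<le> C * ((2 * T + 1) * b) + T * b"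
        using norm_triangle_ineq4[of "e 0 i - e 0 (owner r)" "?u - e 0 (owner r)"]
          agree[of i "owner r"] moveT[of "Suc k" "owner r"] k(1) by simp
      ultimately show "\<exists>u \<in> row_solutions H z r. norm (e 0 i - u) \<le> C * ((2 * T + 1) * b) + T * b"
        by blast
    qed
    then have "norm (e 0 i - c) \<le> K * b" for i
      by (simp add: K_def algebra_simps)
    then have "(norm (e 0 i - c))\<^sup>2 \<le> (K * b)\<^sup>2" for i by (simp add: power_mono)
    then have "sq_error c (e 0) \<le> (\<Sum>i\<in>(UNIV::'n set). (K * b)\<^sup>2)"
      unfolding sq_error_def by (intro sum_mono)
    also have "\<dots> = CARD('n) * K\<^sup>2 * 4 / \<eta> * d"
      using d0 \<eta> by (simp add: b_def power_mult_distrib)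
    also have "\<dots> \<le> Q * d" using d0 by (simp add: Q_def algebra_simps)
    finally have "sq_error c (e 0) \<le> Q * d" .
    then have "sq_error c (e 0) / Q \<le> d" using Q1 by (simp add: field_simps)
    then show "sq_error c (e T) \<le> (1 - 1 / Q) * sq_error c (e 0)"
      by (simp add: d_def algebra_simps)
  qed
qed

section \<open>Mixing and finite histories\<close>

lemma sigma_algebra_generated_events: "sigma_algebra (space M) (generated_events M N X K)"
  unfolding generated_events_def by (rule sigma_algebra_sigma_sets) auto

lemma generated_events_vimage:
  "k \<in> K \<Longrightarrow> A \<in> sets N \<Longrightarrow> {\<omega> \<in> space M. X k \<omega> \<in> A} \<in> generated_events M N X K"
  unfolding generated_events_def by (rule sigma_sets.Basic) (auto simp: vimage_def)

lemma generated_events_mono: "K \<subseteq> L \<Longrightarrow> generated_events M N X K \<subseteq> generated_events M N X L"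
  unfolding generated_events_def by (intro sigma_sets_mono') blast

lemma generated_events_Int:
  assumes "A \<in> generated_events M N X K" "B \<in> generated_events M N X K"
  shows "A \<inter> B \<in> generated_events M N X K"
proof -
  interpret sigma_algebra "space M" "generated_events M N X K" by (rule sigma_algebra_generated_events)
  show ?thesis using assms by (rule Int)
qed

lemma generated_events_finite_Ball:
  assumes "finite J" "\<And>j. j \<in> J \<Longrightarrow> {\<omega> \<in> space M. Q j \<omega>} \<in> generated_events M N X K"
  shows "{\<omega> \<in> space M. \<forall>j\<in>J. Q j \<omega>} \<in> generated_events M N X K"
proof -
  interpret sigma_algebra "space M" "generated_events M N X K" by (rule sigma_algebra_generated_events)
  show ?thesis by (cases "J = {}") (auto intro!: sets_Collect_finite_All' assms)
qed

text \<open>Once the mixing coefficient at gap \<open>g\<close> is below 1/2, an event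
  \<open>g\<close> steps after the past has at least half the probability that independence would
  give. Events spaced by \<open>g\<close> are adjoined one by one, each costing a factor
  \<open>p / 2\<close>, while what has been collected stays in the past of the next one. The gap
  depends on the process only, not on \<open>t\<close>, \<open>n\<close> or the events.\<close>

lemma star_mixing_chain:
  assumes "star_mixing M N X" "0 \<le> p"
  obtains g :: nat where
    "\<And>t n A B. A \<in> generated_events M N X {0..t} \<Longrightarrow>
      (\<And>k. k < n \<Longrightarrow> B k \<in> generated_events M N X {t + Suc k * g}) \<Longrightarrow>
      (\<And>k. k < n \<Longrightarrow> p \<le> measure M (B k)) \<Longrightarrow>
      (p / 2) ^ n * measure M A \<le> measure M (A \<inter> (\<Inter>k<n. B k))"
proof -
  obtain lam :: "nat \<Rightarrow> real" where lam: "lam \<longlonglongrightarrow> 0"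
    and mix: "\<And>m s A B. A \<in> generated_events M N X {0..m} \<Longrightarrow> B \<in> generated_events M N X {m + s..} \<Longrightarrow>
          \<bar>measure M (A \<inter> B) - measure M A * measure M B\<bar> \<le> lam s * measure M A * measure M B"
    using assms(1) unfolding star_mixing_def by blast
  obtain g where "lam g < 1 / 2"
    using order_tendstoD(2)[OF lam, of "1 / 2"] by (auto simp: eventually_sequentially)
  then have half: "measure M A * measure M B / 2 \<le> measure M (A \<inter> B)"
    if "A \<in> generated_events M N X {0..m}" "B \<in> generated_events M N X {m + g..}" for m A B
  proof -
    have "lam g * (measure M A * measure M B) \<le> 1 / 2 * (measure M A * measure M B)"
      using \<open>lam g < 1 / 2\<close> by (intro mult_right_mono) auto
    then show ?thesis using mix[OF that] by (simp add: mult.assoc)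
  qed
  show thesis
  proof (rule that)
    fix t n A and B :: "nat \<Rightarrow> 'a set"
    assume A: "A \<in> generated_events M N X {0..t}"
      and B: "\<And>k. k < n \<Longrightarrow> B k \<in> generated_events M N X {t + Suc k * g}"
      and p: "\<And>k. k < n \<Longrightarrow> p \<le> measure M (B k)"
    have "A \<inter> (\<Inter>k<j. B k) \<in> generated_events M N X {0..t + j * g} \<and>
      (p / 2) ^ j * measure M A \<le> measure M (A \<inter> (\<Inter>k<j. B k))" if "j \<le> n" for j
      using that
    proof (induction j)
      case 0
      then show ?case using A by simp
    next
      case (Suc j)
      let ?C = "A \<inter> (\<Inter>k<j. B k)"
      have C: "?C \<in> generated_events M N X {0..t + j * g}"
        and ih: "(p / 2) ^ j * measure M A \<le> measure M ?C"
        using Suc by auto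
      have Bj: "B j \<in> generated_events M N X {t + Suc j * g}" using B Suc.prems by simp
      have eq: "A \<inter> (\<Inter>k<Suc j. B k) = ?C \<inter> B j" by (auto simp: lessThan_Suc)
      have "?C \<inter> B j \<in> generated_events M N X {0..t + Suc j * g}"
        by (intro generated_events_Int subsetD[OF generated_events_mono C] subsetD[OF generated_events_mono Bj])
          auto
      moreover have "(p / 2) ^ Suc j * measure M A \<le> measure M (?C \<inter> B j)"
      proof -
        have "(p / 2) ^ Suc j * measure M A = (p / 2) ^ j * measure M A * p / 2" by simp
        also have "\<dots> \<le> measure M ?C * measure M (B j) / 2"
          using ih p[of j] Suc.prems assms(2) by (intro divide_right_mono mult_mono) auto
        also have "\<dots> \<le> measure M (?C \<inter> B j)"
          by (rule half[OF C subsetD[OF generated_events_mono Bj]]) auto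
        finally show ?thesis .
      qed
      ultimately show ?case unfolding eq by simp
    qed
    then show "(p / 2) ^ n * measure M A \<le> measure M (A \<inter> (\<Inter>k<n. B k))" by simp
  qed
qed

text \<open>
  The discrete form of conditioning on the history \<open>h\<close>: a conditional lower bound for the
  probability of \<open>G\<close> on each atom of \<open>h\<close> transfers to weights that are constant on the atoms.
\<close>

lemma (in prob_space) expectation_finite_history:
  fixes f :: "'a \<Rightarrow> real" and h :: "'a \<Rightarrow> 'h"
  assumes fin: "finite (h ` space M)"
    and atoms: "\<And>\<omega>. \<omega> \<in> space M \<Longrightarrow> {\<omega>' \<in> space M. h \<omega>' = h \<omega>} \<in> events"
    and f: "\<And>\<omega> \<omega>'. \<omega> \<in> space M \<Longrightarrow> \<omega>' \<in> space M \<Longrightarrow> h \<omega> = h \<omega>' \<Longrightarrow> f \<omega> = f \<omega>'"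
  shows "integrable M f"
    and "G \<in> events \<Longrightarrow> (\<And>\<omega>. \<omega> \<in> space M \<Longrightarrow> 0 \<le> f \<omega>) \<Longrightarrow>
      (\<And>\<omega>. \<omega> \<in> space M \<Longrightarrow>
        \<delta> * prob {\<omega>' \<in> space M. h \<omega>' = h \<omega>} \<le> prob ({\<omega>' \<in> space M. h \<omega>' = h \<omega>} \<inter> G)) \<Longrightarrow>
      \<delta> * expectation f \<le> expectation (\<lambda>\<omega>. f \<omega> * indicator G \<omega>)"
proof -
  define V where "V = h ` space M"
  define A where "A v = {\<omega> \<in> space M. h \<omega> = v}" for v
  \<comment> \<open>The common value of \<open>f\<close> on the atom \<open>A v\<close>; the choice
    of the representative is immaterial because \<open>f\<close> is constant there. This makes
    \<open>f\<close> a finite combination of indicators.\<close>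
  define g where "g v = f (SOME \<omega>. \<omega> \<in> A v)" for v
  have finV: "finite V" using fin by (simp add: V_def)
  have Aev [simp]: "A v \<in> events" if "v \<in> V" for v using that atoms by (auto simp: A_def V_def)
  have g: "g (h \<omega>) = f \<omega>" if "\<omega> \<in> space M" for \<omega>
  proof -
    have "\<omega> \<in> A (h \<omega>)" using that by (simp add: A_def)
    then have "(SOME \<omega>'. \<omega>' \<in> A (h \<omega>)) \<in> A (h \<omega>)" by (rule someI)
    then show ?thesis unfolding g_def by (intro f that) (simp_all add: A_def)
  qed
  have f_eq: "f \<omega> = (\<Sum>v\<in>V. g v * indicator (A v) \<omega>)" if "\<omega> \<in> space M" for \<omega>
  proof -
    have "(\<Sum>v\<in>V. g v * indicator (A v) \<omega>) = (\<Sum>v\<in>V. if v = h \<omega> then g v else 0)"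
      using that by (intro sum.cong) (auto simp: A_def)
    then show ?thesis using that finV g by (simp add: V_def)
  qed
  have int: "integrable M (\<lambda>\<omega>. \<Sum>v\<in>V. g v * indicator (A v) \<omega>)"
    by (intro Bochner_Integration.integrable_sum integrable_mult_right) (auto simp: integrable_indicator_iff emeasure_eq_measure)
  moreover have "integrable M f \<longleftrightarrow> integrable M (\<lambda>\<omega>. \<Sum>v\<in>V. g v * indicator (A v) \<omega>)"
    by (rule Bochner_Integration.integrable_cong[OF refl]) (rule f_eq)
  ultimately show "integrable M f" by simp
  assume G: "G \<in> events" and f0: "\<And>\<omega>. \<omega> \<in> space M \<Longrightarrow> 0 \<le> f \<omega>"
    and \<delta>: "\<And>\<omega>. \<omega> \<in> space M \<Longrightarrow>
        \<delta> * prob {\<omega>' \<in> space M. h \<omega>' = h \<omega>} \<le> prob ({\<omega>' \<in> space M. h \<omega>' = h \<omega>} \<inter> G)"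
  have "expectation f = (\<integral>\<omega>. (\<Sum>v\<in>V. g v * indicator (A v) \<omega>) \<partial>M)"
    by (rule Bochner_Integration.integral_cong[OF refl f_eq])
  also have "\<dots> = (\<Sum>v\<in>V. g v * prob (A v))"
    by (subst Bochner_Integration.integral_sum)
      (auto simp: integrable_indicator_iff emeasure_eq_measure intro!: integrable_mult_right)
  finally have E1: "expectation f = (\<Sum>v\<in>V. g v * prob (A v))" .
  have AG: "A v \<inter> G \<inter> space M = A v \<inter> G" for v by (auto simp: A_def)
  have "expectation (\<lambda>\<omega>. f \<omega> * indicator G \<omega>) = (\<integral>\<omega>. (\<Sum>v\<in>V. g v * indicator (A v \<inter> G) \<omega>) \<partial>M)"
    by (rule Bochner_Integration.integral_cong) (simp_all add: f_eq sum_distrib_right indicator_inter_arith mult.assoc)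
  also have "\<dots> = (\<Sum>v\<in>V. g v * prob (A v \<inter> G))"
    using G AG by (subst Bochner_Integration.integral_sum)
      (auto simp: integrable_indicator_iff emeasure_eq_measure intro!: integrable_mult_right)
  finally have E2: "expectation (\<lambda>\<omega>. f \<omega> * indicator G \<omega>) = (\<Sum>v\<in>V. g v * prob (A v \<inter> G))" .
  have "\<delta> * (g v * prob (A v)) \<le> g v * prob (A v \<inter> G)" if v: "v \<in> V" for v
  proof -
    obtain \<omega> where "\<omega> \<in> space M" "v = h \<omega>" using v by (auto simp: V_def)
    then have "0 \<le> g v" "\<delta> * prob (A v) \<le> prob (A v \<inter> G)" using f0 g \<delta> by (auto simp: A_def)
    then have "g v * (\<delta> * prob (A v)) \<le> g v * prob (A v \<inter> G)" by (intro mult_left_mono)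
    then show ?thesis by (simp add: mult.left_commute)
  qed
  then show "\<delta> * expectation f \<le> expectation (\<lambda>\<omega>. f \<omega> * indicator G \<omega>)"
    unfolding E1 E2 sum_distrib_left by (intro sum_mono)
qed

text \<open>Iterating over complete windows gives decay in \<open>t div T\<close>; monotonicity
  covers the remaining steps, and a \<open>T\<close>-th root converts the rate per window into a
  rate per step.\<close>

lemma geometric_decay_of_windows:
  fixes a :: "nat \<Rightarrow> real"
  assumes "decseq a" "\<And>t. 0 \<le> a t" "0 < T" "q < 1" "\<And>t. a (t + T) \<le> q * a t"
  obtains \<mu> c where "0 < \<mu>" "\<mu> < 1" "0 < c" "\<And>t. a t \<le> c * \<mu> ^ t"
proof -
  \<comment> \<open>The maximum with 1/2 keeps the ratio positive even if \<open>q\<close> is not,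
    so that it has a positive root and can be divided by.\<close>
  define r where "r = max q (1 / 2)"
  define \<mu> where "\<mu> = root T r"
  have r: "0 < r" "r < 1" using assms(4) by (auto simp: r_def)
  have \<mu>: "0 < \<mu>" "\<mu> < 1" "\<mu> ^ T = r" using r assms(3) by (auto simp: \<mu>_def)
  have block: "a (t + k * T) \<le> r ^ k * a t" for t k
  proof (induction k)
    case (Suc k)
    have "a (t + Suc k * T) \<le> q * a (t + k * T)"
      using assms(5)[of "t + k * T"] by (simp add: algebra_simps)
    also have "\<dots> \<le> r * a (t + k * T)" using assms(2) by (intro mult_right_mono) (auto simp: r_def)
    also have "\<dots> \<le> r * (r ^ k * a t)" using Suc r by (intro mult_left_mono) auto
    finally show ?case by simp
  qed simp
  show thesis
  proof (rule that[OF \<mu>(1,2)])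
    \<comment> \<open>Adding 1 keeps the constant positive when \<open>a 0 = 0\<close>; dividing by
      \<open>r\<close> pays for the last, incomplete window.\<close>
    show "0 < (a 0 + 1) / r" using assms(2)[of 0] r by simp
    fix t
    have "a t \<le> a (0 + (t div T) * T)" by (rule decseqD[OF assms(1)]) simp
    also have "\<dots> \<le> r ^ (t div T) * a 0" by (rule block)
    also have "r ^ (t div T) = \<mu> ^ (T * (t div T))" by (simp add: \<mu>(3) power_mult)
    finally have at: "a t \<le> \<mu> ^ (T * (t div T)) * a 0" .
    have "t \<le> T * (t div T) + T"
      using mod_less_divisor[OF assms(3), of t] mult_div_mod_eq[of T t] by linarith
    then have "\<mu> ^ (T * (t div T) + T) \<le> \<mu> ^ t" using \<mu> by (intro power_decreasing) auto
    then have "\<mu> ^ (T * (t div T)) \<le> \<mu> ^ t / r" using r by (simp add: power_add \<mu>(3) field_simps)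
    then have "\<mu> ^ (T * (t div T)) * a 0 \<le> \<mu> ^ t / r * (a 0 + 1)"
      using assms(2)[of 0] \<mu>(1) r by (intro mult_mono) auto
    with at show "a t \<le> (a 0 + 1) / r * \<mu> ^ t" by (simp add: algebra_simps)
  qed
qed

text \<open>Convergence of the means gives almost sure convergence along a subsequence only. Each
  path is decreasing and bounded below, so it has a limit, which the subsequence identifies as
  0.\<close>

lemma AE_tendsto_0_of_decseq_L1:
  fixes V :: "nat \<Rightarrow> 'a \<Rightarrow> real"
  assumes int: "\<And>t. integrable M (V t)" and lim: "(\<lambda>t. \<integral>\<omega>. V t \<omega> \<partial>M) \<longlonglongrightarrow> 0"
    and V: "\<And>t \<omega>. \<omega> \<in> space M \<Longrightarrow> 0 \<le> V t \<omega>" "\<And>\<omega>. \<omega> \<in> space M \<Longrightarrow> decseq (\<lambda>t. V t \<omega>)"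
  shows "AE \<omega> in M. (\<lambda>t. V t \<omega>) \<longlonglongrightarrow> 0"
proof -
  have "(\<integral>\<omega>. norm (V t \<omega>) \<partial>M) = (\<integral>\<omega>. V t \<omega> \<partial>M)" for t
    by (intro Bochner_Integration.integral_cong) (auto simp: V(1))
  then have "(\<lambda>t. \<integral>\<omega>. norm (V t \<omega>) \<partial>M) \<longlonglongrightarrow> 0" using lim by simp
  from tendsto_L1_AE_subseq[of M V, OF int this]
  obtain r :: "nat \<Rightarrow> nat" where r: "strict_mono r" "AE \<omega> in M. (\<lambda>n. V (r n) \<omega>) \<longlonglongrightarrow> 0"
    by (elim exE conjE) (rule that)
  have "(\<lambda>t. V t \<omega>) \<longlonglongrightarrow> 0" if \<omega>: "\<omega> \<in> space M" and sub: "(\<lambda>n. V (r n) \<omega>) \<longlonglongrightarrow> 0" for \<omega>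
  proof -
    obtain L where L: "(\<lambda>t. V t \<omega>) \<longlonglongrightarrow> L"
      by (rule decseq_convergent[OF V(2)[OF \<omega>], where B = 0]) (auto simp: V(1)[OF \<omega>])
    have "(\<lambda>n. V (r n) \<omega>) \<longlonglongrightarrow> L"
      using LIMSEQ_subseq_LIMSEQ[OF L r(1)] by (simp add: o_def)
    then show ?thesis using LIMSEQ_unique[OF _ sub] L by blast
  qed
  then show ?thesis using r(2) by (auto elim!: AE_mp)
qed

text \<open>Every set of the pulled-back algebra is a preimage under \<open>X\<close>, so the fibre
  of \<open>W\<close> through one point contains all points with the same \<open>X\<close>. It makes
  the weight matrix a function of the current graph.\<close>

lemma vimage_algebra_borel_factor:
  fixes W :: "'a \<Rightarrow> 'b::t1_space"
  assumes W: "W \<in> borel_measurable (vimage_algebra S X (count_space UNIV))"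
    and "\<omega> \<in> S" "\<omega>' \<in> S" "X \<omega> = X \<omega>'"
  shows "W \<omega> = W \<omega>'"
proof -
  have "W -` {W \<omega>} \<inter> S \<in> sets (vimage_algebra S X (count_space UNIV))"
    using measurable_sets[OF W, of "{W \<omega>}"] by simp
  then obtain A where "W -` {W \<omega>} \<inter> S = X -` A \<inter> S"
    by (auto simp: sets_vimage_algebra2)
  moreover have "\<omega> \<in> W -` {W \<omega>} \<inter> S" using assms(2) by simp
  ultimately have "\<omega>' \<in> W -` {W \<omega>} \<inter> S" using assms(2-4) by simp
  then show ?thesis by simp
qed

lemma link_matrix_eq_1_iff: "link_matrix E $ i $ j = 1 \<longleftrightarrow> {i, j} \<in> E"
  by (simp add: link_matrix_def)

text \<open>Mixing is stated for link matrices, whereas histories record edge sets. Within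
  \<open>all_edges\<close> every edge is a pair of nodes and so is visible as a matrix
  entry.\<close>

lemma link_matrix_inj: "inj_on link_matrix (Pow all_edges)"
proof (rule inj_onI)
  fix E E' :: "'n::finite set set"
  assume EE: "E \<in> Pow all_edges" "E' \<in> Pow all_edges" "link_matrix E = link_matrix E'"
  have "{i, j} \<in> E \<longleftrightarrow> {i, j} \<in> E'" for i j
    using arg_cong[OF EE(3), of "\<lambda>A. A $ i $ j = 1"] by (simp add: link_matrix_eq_1_iff)
  then have iff: "a \<in> E \<longleftrightarrow> a \<in> E'" if "a \<in> all_edges" for a
    using that unfolding all_edges_def by (elim CollectE exE conjE) (simp only:)
  show "E = E'"
  proof (intro set_eqI iffI)
    show "a \<in> E'" if "a \<in> E" for a using iff[of a] subsetD[OF PowD[OF EE(1)] that] that by simp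
    show "a \<in> E" if "a \<in> E'" for a using iff[of a] subsetD[OF PowD[OF EE(2)] that] that by simp
  qed
qed

lemma (in prob_space) prob_indep_vars_point:
  assumes "indep_vars (\<lambda>_. count_space UNIV) X UNIV" "finite J"
  shows "prob {\<omega> \<in> space M. \<forall>j\<in>J. X j \<omega> = v j} = (\<Prod>j\<in>J. prob {\<omega> \<in> space M. X j \<omega> = v j})"
proof (cases "J = {}")
  case False
  have "{\<omega> \<in> space M. \<forall>j\<in>J. X j \<omega> = v j} = (\<Inter>j\<in>J. X j -` {v j} \<inter> space M)"
    using False by auto
  moreover have "X j -` {v j} \<inter> space M = {\<omega> \<in> space M. X j \<omega> = v j}" for j by auto
  ultimately show ?thesis
    using indep_varsD[OF assms(1) False assms(2), of "\<lambda>j. {v j}"] by simp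
qed (simp add: prob_space)

lemma matrix_entry_eq_borel: "{A :: real^'n::finite^'m::finite. A $ i $ j = c} \<in> sets borel"
  by (intro borel_closed closed_Collect_eq continuous_intros)

section \<open>Convergence of the algorithm\<close>

theorem theorem3:
  fixes M :: "'w measure"
    and H :: "real^'m::finite^'l::{finite,linorder}"
    and z :: "real^'l::{finite,linorder}"
    and owner :: "'l \<Rightarrow> 'n::{finite,linorder}"
    and xstar :: "real^'m"
    and E :: "nat \<Rightarrow> 'w \<Rightarrow> 'n set set"
    and W :: "nat \<Rightarrow> 'w \<Rightarrow> real^'n::{finite,linorder}^'n::{finite,linorder}"
    and s :: "'n \<Rightarrow> nat \<Rightarrow> 'w \<Rightarrow> 'l"
    and x0 :: "'n::{finite,linorder} \<Rightarrow> real^'m"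
    and x :: "nat \<Rightarrow> 'n \<Rightarrow> 'w \<Rightarrow> real^'m"
    and p \<eta> :: real
  assumes "prob_space M"
    \<comment> \<open>linear equation and its blocks\<close>
    and "mono owner"
    and "\<And>i. \<exists>r \<in> block_rows owner i. row r H \<noteq> 0"
    and "H *v xstar = z" and "\<And>y. H *v y = z \<Longrightarrow> y = xstar"
    \<comment> \<open>random graph process\<close>
    and "\<And>t. E t \<in> measurable M (count_space UNIV)"
    and "\<And>t \<omega>. \<omega> \<in> space M \<Longrightarrow> E t \<omega> \<subseteq> all_edges"
    and "star_mixing M borel (\<lambda>t \<omega>. link_matrix (E t \<omega>))"
    and "0 < p" and "p < 1"
    and "graph_connected (persistent_edges M E p)"
    \<comment> \<open>weights\<close>
    and "\<And>t. W t \<in> borel_measurable (vimage_algebra (space M) (E t) (count_space UNIV))"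
    and "0 < \<eta>" and "\<eta> < 1"
    and "\<And>t \<omega>. \<omega> \<in> space M \<Longrightarrow> mixing_weights \<eta> (E t \<omega>) (W t \<omega>)"
    \<comment> \<open>randomized row selection\<close>
    and "\<And>i t \<omega>. \<omega> \<in> space M \<Longrightarrow> s i t \<omega> \<in> block_rows owner i"
    and "\<And>i t r. r \<in> block_rows owner i \<Longrightarrow>
           measure M {\<omega> \<in> space M. s i t \<omega> = r}
             = (norm (row r H))\<^sup>2 / (block_frobenius H owner i)\<^sup>2"
    and "prob_space.indep_vars M (\<lambda>_. count_space UNIV) (\<lambda>(i, t). s i t) UNIV"
    and "prob_space.indep_set M
           (generated_events M (count_space UNIV) (\<lambda>(i, t). s i t) UNIV)
           (generated_events M borel (\<lambda>t \<omega>. link_matrix (E t \<omega>)) UNIV)"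
    \<comment> \<open>the algorithm\<close>
    and "\<And>i \<omega>. \<omega> \<in> space M \<Longrightarrow> x 0 i \<omega> = x0 i"
    and "\<And>t i \<omega>. \<omega> \<in> space M \<Longrightarrow>
           x (Suc t) i \<omega> = closest_point (row_solutions H z (s i t \<omega>))
                              (\<Sum>j\<in>UNIV. W t \<omega> $ i $ j *\<^sub>R x t j \<omega>)"
  shows "(AE \<omega> in M. \<forall>i. (\<lambda>t. x t i \<omega>) \<longlonglongrightarrow> xstar) \<and>
         (\<exists>\<mu>2 c2 :: real. 0 < \<mu>2 \<and> \<mu>2 < 1 \<and> 0 < c2 \<and>
           (\<forall>t. integrable M (\<lambda>\<omega>. \<Sum>i\<in>UNIV. (norm (x t i \<omega> - xstar))\<^sup>2) \<and>
                prob_space.expectation M (\<lambda>\<omega>. \<Sum>i\<in>UNIV. (norm (x t i \<omega> - xstar))\<^sup>2)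
                  \<le> c2 * \<mu>2 ^ t))"
proof -
  note sol = assms(4,5) and Em = assms(6) and Esub = assms(7) and p0 = assms(9)
    and eta = assms(13,14) and Ww = assms(15) and sind = assms(18)
    and x0 = assms(20) and xS = assms(21)
  interpret prob_space M by (rule assms(1))
  define X where "X = (\<lambda>(i, t). s i t)"
  define FE where "FE = generated_events M borel (\<lambda>t \<omega>. link_matrix (E t \<omega>))"
  define FS where "FS = generated_events M (count_space UNIV) X UNIV"
  define P where "P = persistent_edges M E p"
  have indS: "indep_vars (\<lambda>_. count_space UNIV) X UNIV" using sind by (simp add: X_def)
  have indSE: "indep_set FS (FE UNIV)" using assms(19) by (simp add: FS_def FE_def X_def)
  have FS_ev: "FS \<subseteq> events" and FE_ev: "FE UNIV \<subseteq> events"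
    using indep_setD_ev1[OF indSE] indep_setD_ev2[OF indSE] by auto

  \<comment> \<open>Squared error and finite histories\<close>
  define V where "V t \<omega> = sq_error xstar (\<lambda>i. x t i \<omega>)" for t \<omega>
  \<comment> \<open>The graphs and selections of the steps before \<open>t\<close>. They range over
    a finite type, so there are finitely many histories of length \<open>t\<close>; the weights are
    functions of the graphs, so the history determines the states at time \<open>t\<close>.\<close>
  define h where "h t \<omega> = map (\<lambda>k. (E k \<omega>, \<lambda>i. s i k \<omega>)) [0..<t]" for t \<omega>
  have h_eq: "h t \<omega> = h t \<omega>' \<longleftrightarrow> (\<forall>k\<in>{..<t}. E k \<omega> = E k \<omega>' \<and> (\<forall>i. s i k \<omega> = s i k \<omega>'))" for t \<omega> \<omega>'
    by (auto simp: h_def fun_eq_iff)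
  have h_fin: "finite (h t ` space M)" for t
    by (rule finite_subset[OF _ finite_lists_length_eq[OF finite_class.finite_UNIV, of t]]) (auto simp: h_def)
  have x_hist: "x t i \<omega> = x t i \<omega>'"
    if "\<omega> \<in> space M" "\<omega>' \<in> space M" "h t \<omega> = h t \<omega>'" for t i \<omega> \<omega>'
    using that(3)
  proof (induction t arbitrary: i)
    case 0
    then show ?case using that x0 by simp
  next
    case (Suc t)
    have "W t \<omega> = W t \<omega>'"
      using vimage_algebra_borel_factor[OF assms(12) that(1,2)] Suc.prems unfolding h_eq by auto
    moreover have "x t j \<omega> = x t j \<omega>'" for j
      using Suc.IH Suc.prems unfolding h_eq by auto
    moreover have "s i t \<omega> = s i t \<omega>'" using Suc.prems unfolding h_eq by auto
    ultimately show ?case using xS that(1,2) by simp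
  qed
  have V_hist: "V t \<omega> = V t \<omega>'" if "\<omega> \<in> space M" "\<omega>' \<in> space M" "h t \<omega> = h t \<omega>'" for t \<omega> \<omega>'
    unfolding V_def using x_hist[OF that] by simp

  have V0: "0 \<le> V t \<omega>" for t \<omega> by (simp add: V_def)
  have V_dec: "decseq (\<lambda>t. V t \<omega>)" if "\<omega> \<in> space M" for \<omega>
    unfolding decseq_Suc_iff V_def
    by (intro allI projection_consensus_step(1)[OF Ww[OF that] eta row_solutions_convex_closed
          mem_row_solutions[OF sol(1)] xS[OF that]])

  \<comment> \<open>Prescribed row selections and their probabilities\<close>
  obtain rs where rs: "set rs = {r. row r H \<noteq> 0}" using finite_list[OF finite] by blast
  obtain \<rho>0 where \<rho>0: "\<And>i. \<rho>0 i \<in> block_rows owner i" "\<And>i. row (\<rho>0 i) H \<noteq> 0"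
    using assms(3) by metis
  define L where "L = length rs"
  \<comment> \<open>In slot \<open>u\<close> the owner of the \<open>u\<close>-th nonzero row has to
    select that row. All other nodes are assigned a default nonzero row, so that every node has a
    prescribed choice of positive probability in every slot.\<close>
  define \<rho> where "\<rho> u i = (if u < L \<and> owner (rs ! u) = i then rs ! u else \<rho>0 i)" for u i
  have \<rho>: "\<rho> u i \<in> block_rows owner i" "row (\<rho> u i) H \<noteq> 0" for u i
    using \<rho>0 rs nth_mem[of u rs] by (auto simp: \<rho>_def L_def block_rows_def)
  have \<rho>_all: "\<exists>u<L. \<rho> u (owner r) = r" if "row r H \<noteq> 0" for r
  proof -
    have "r \<in> set rs" using that rs by simp
    then obtain u where "u < L" "rs ! u = r" by (auto simp: in_set_conv_nth L_def)
    then show ?thesis by (intro exI[of _ u]) (auto simp: \<rho>_def)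
  qed
  define q where "q r = (norm (row r H))\<^sup>2 / (block_frobenius H owner (owner r))\<^sup>2" for r
  have q0: "0 < q r" if "row r H \<noteq> 0" for r
  proof -
    have "0 < (norm (row r H))\<^sup>2" using that by simp
    also have "(norm (row r H))\<^sup>2 = (\<Sum>k\<in>UNIV. (H $ r $ k)\<^sup>2)"
      by (simp only: power2_norm_eq_inner) (simp add: inner_vec_def row_def power2_eq_square)
    also have "\<dots> \<le> (\<Sum>r'\<in>block_rows owner (owner r). \<Sum>k\<in>UNIV. (H $ r' $ k)\<^sup>2)"
      by (rule member_le_sum) (auto simp: block_rows_def intro: sum_nonneg)
    finally show ?thesis using that by (simp add: q_def block_frobenius_def)
  qed
  \<comment> \<open>A uniform lower bound for the probability of any prescribed selection.\<close>
  define c where "c = Min (q ` {r. row r H \<noteq> 0})"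
  have ne: "{r. row r H \<noteq> 0} \<noteq> {}" using \<rho>0(2) by blast
  have c0: "0 < c" unfolding c_def using ne q0 by (subst Min_gr_iff) auto
  have c_le: "c \<le> q r" if "row r H \<noteq> 0" for r unfolding c_def using that by (intro Min_le) auto

  \<comment> \<open>Window length and contraction factor\<close>
  obtain es where es: "set es = P" using finite_list[of P] by auto
  define K where "K = length es"
  obtain g :: nat where chain:
    "\<And>t n A B. A \<in> FE {0..t} \<Longrightarrow>
      (\<And>k. k < n \<Longrightarrow> B k \<in> FE {t + Suc k * g}) \<Longrightarrow>
      (\<And>k. k < n \<Longrightarrow> p \<le> prob (B k)) \<Longrightarrow>
      (p / 2) ^ n * prob A \<le> prob (A \<inter> (\<Inter>k<n. B k))"
    using star_mixing_chain[OF assms(8), of p] p0 unfolding FE_def by (metis less_imp_le)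
  \<comment> \<open>Row selections use the first \<open>L\<close> steps of a window; edge \<open>k\<close> is awaited at offset \<open>Suc k * g\<close>.\<close>
  define T where "T = L + K * g + 1"

  obtain \<kappa> where \<kappa>: "0 < \<kappa>" "\<kappa> \<le> 1"
    "\<And>e E W s.
      (\<And>k. k < T \<Longrightarrow> mixing_weights \<eta> (E k) (W k)) \<Longrightarrow>
      (\<And>k i. k < T \<Longrightarrow> e (Suc k) i =
         closest_point (row_solutions H z (s k i)) (\<Sum>j\<in>UNIV. W k $ i $ j *\<^sub>R e k j)) \<Longrightarrow>
      (\<And>a. a \<in> P \<Longrightarrow> \<exists>k<T. a \<in> E k) \<Longrightarrow>
      (\<And>r. row r H \<noteq> 0 \<Longrightarrow> \<exists>k<T. s k (owner r) = r) \<Longrightarrow>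
      sq_error xstar (e T) \<le> (1 - \<kappa>) * sq_error xstar (e 0)"
    using window_contraction[OF sol assms(11) eta, of T owner] unfolding P_def by blast

  \<comment> \<open>Good windows\<close>
  define GE where "GE t = (\<Inter>k<K. {\<omega> \<in> space M. es ! k \<in> E (t + Suc k * g) \<omega>})" for t
  define GS where "GS t = {\<omega> \<in> space M. \<forall>j\<in>UNIV \<times> {t..<t + L}. X j \<omega> = \<rho> (snd j - t) (fst j)}" for t
  \<comment> \<open>If there are no persistent edges, as with a single node, \<open>GE t\<close> is
    an empty intersection, that is, the whole type; intersecting with \<open>space M\<close> keeps
    \<open>G t\<close> inside the space.\<close>
  define G where "G t = space M \<inter> GE t \<inter> GS t" for t

  have contract: "V (t + T) \<omega> \<le> (1 - \<kappa>) * V t \<omega>" if \<omega>: "\<omega> \<in> G t" for t \<omega>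
  proof -
    have sp: "\<omega> \<in> space M" using \<omega> by (simp add: G_def)
    have "sq_error xstar ((\<lambda>k i. x (t + k) i \<omega>) T) \<le> (1 - \<kappa>) * sq_error xstar ((\<lambda>k i. x (t + k) i \<omega>) 0)"
    proof (rule \<kappa>(3))
      show "mixing_weights \<eta> (E (t + k) \<omega>) (W (t + k) \<omega>)" for k by (rule Ww[OF sp])
      show "x (t + Suc k) i \<omega> = closest_point (row_solutions H z (s i (t + k) \<omega>))
          (\<Sum>j\<in>UNIV. W (t + k) \<omega> $ i $ j *\<^sub>R x (t + k) j \<omega>)" for k i
        using xS[OF sp] by simp
      show "\<exists>k<T. a \<in> E (t + k) \<omega>" if a: "a \<in> P" for a
      proof -
        obtain k where k: "k < K" "es ! k = a" using a es by (auto simp: K_def in_set_conv_nth)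
        then have "a \<in> E (t + Suc k * g) \<omega>" using \<omega> by (auto simp: G_def GE_def)
        moreover have "Suc k * g \<le> K * g" using k(1) by (intro mult_right_mono) auto
        \<comment> \<open>The final \<open>+ 1\<close> in \<open>T\<close> makes room for the last
          edge, at offset \<open>K * g\<close>.\<close>
        then have "Suc k * g < T" unfolding T_def by linarith
        ultimately show ?thesis by blast
      qed
      show "\<exists>k<T. s (owner r) (t + k) \<omega> = r" if nz: "row r H \<noteq> 0" for r
      proof -
        obtain u where u: "u < L" "\<rho> u (owner r) = r" using \<rho>_all[OF nz] by blast
        have "\<forall>j\<in>UNIV \<times> {t..<t + L}. X j \<omega> = \<rho> (snd j - t) (fst j)"
          using \<omega> by (simp add: G_def GS_def)
        from bspec[OF this, of "(owner r, t + u)"] have "s (owner r) (t + u) \<omega> = r"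
          using u by (simp add: X_def)
        then show ?thesis using u(1) by (intro exI[of _ u]) (simp add: T_def)
      qed
    qed
    then show ?thesis by (simp add: V_def)
  qed

  \<comment> \<open>Measurability with respect to graphs and selections\<close>
  have edge_ev: "{\<omega> \<in> space M. {i, j} \<in> E k \<omega>} \<in> FE J" if "k \<in> J" for i j k J
  proof -
    from generated_events_vimage[OF that matrix_entry_eq_borel, of M "\<lambda>t \<omega>. link_matrix (E t \<omega>)" i j 1]
    show ?thesis by (simp add: FE_def link_matrix_eq_1_iff)
  qed
  \<comment> \<open>Injectivity of \<open>link_matrix\<close> turns equality of graphs into an event
    about link matrices.\<close>
  have Eeq_ev: "{\<omega>' \<in> space M. E k \<omega>' = E k \<omega>} \<in> FE J" if "k \<in> J" "\<omega> \<in> space M" for k J \<omega>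
  proof -
    have "E k \<omega>' = E k \<omega> \<longleftrightarrow> link_matrix (E k \<omega>') = link_matrix (E k \<omega>)" if "\<omega>' \<in> space M" for \<omega>'
      using inj_on_eq_iff[OF link_matrix_inj PowI[OF Esub] PowI[OF Esub]] that \<open>\<omega> \<in> space M\<close> by metis
    then have "{\<omega>' \<in> space M. E k \<omega>' = E k \<omega>} =
        {\<omega>' \<in> space M. link_matrix (E k \<omega>') \<in> {link_matrix (E k \<omega>)}}"
      by (intro Collect_cong conj_cong refl) simp
    then show ?thesis
      using generated_events_vimage[OF that(1), of "{link_matrix (E k \<omega>)}" borel M "\<lambda>t \<omega>. link_matrix (E t \<omega>)"]
      by (simp add: FE_def)
  qed
  have X_ev: "{\<omega> \<in> space M. X j \<omega> = r} \<in> FS" for j r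
    using generated_events_vimage[of j UNIV "{r}" "count_space UNIV" M X] by (simp add: FS_def)
  have FS_all: "{\<omega> \<in> space M. \<forall>j\<in>J. X j \<omega> = v j} \<in> FS" if "finite J" for J v
    unfolding FS_def using X_ev by (intro generated_events_finite_Ball that) (simp add: FS_def)

  \<comment> \<open>Probability of a good window given the history\<close>
  define HE where "HE t \<omega> = {\<omega>' \<in> space M. \<forall>k\<in>{..<t}. E k \<omega>' = E k \<omega>}" for t \<omega>
  define HS where "HS t \<omega> = {\<omega>' \<in> space M. \<forall>j\<in>UNIV \<times> {..<t}. X j \<omega>' = X j \<omega>}" for t \<omega>
  \<comment> \<open>Each atom splits into a graph part, treated by mixing, and a selection part,
    treated by independence.\<close>
  have atom: "{\<omega>' \<in> space M. h t \<omega>' = h t \<omega>} = HE t \<omega> \<inter> HS t \<omega>" for t \<omega>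
    by (auto simp: h_eq HE_def HS_def X_def)
  have HE_FE: "HE t \<omega> \<in> FE {0..t}" if "\<omega> \<in> space M" for t \<omega>
    unfolding HE_def FE_def
    by (intro generated_events_finite_Ball) (use Eeq_ev[OF _ that] in \<open>auto simp: FE_def\<close>)
  have FE_UNIV: "A \<in> FE UNIV" if "A \<in> FE J" for A J
    using that generated_events_mono[of J UNIV] unfolding FE_def by blast
  have es_pair: "\<exists>i j. es ! k = {i, j} \<and> (\<forall>t. p \<le> prob {\<omega> \<in> space M. {i, j} \<in> E t \<omega>})" if "k < K" for k
    using that es nth_mem[of k es] by (auto simp: K_def P_def persistent_edges_def)
  have B_FE: "{\<omega> \<in> space M. es ! k \<in> E (t + Suc k * g) \<omega>} \<in> FE {t + Suc k * g}" if "k < K" for k t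
    using es_pair[OF that] edge_ev[of "t + Suc k * g" "{t + Suc k * g}"] by auto
  have FE_Int: "A \<inter> B \<in> FE J" if "A \<in> FE J" "B \<in> FE J" for A B J
    using that unfolding FE_def by (rule generated_events_Int)
  have GE_FE: "{\<omega> \<in> space M. \<forall>k\<in>{..<K}. es ! k \<in> E (t + Suc k * g) \<omega>} \<in> FE UNIV" for t
    using FE_UNIV[OF B_FE] unfolding FE_def by (intro generated_events_finite_Ball) auto
  have HGE_FE: "HE t \<omega> \<inter> GE t \<in> FE UNIV" if "\<omega> \<in> space M" for t \<omega>
  proof -
    have eq: "HE t \<omega> \<inter> GE t = HE t \<omega> \<inter> {\<omega> \<in> space M. \<forall>k\<in>{..<K}. es ! k \<in> E (t + Suc k * g) \<omega>}"
      by (auto simp: HE_def GE_def)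
    show ?thesis unfolding eq by (rule FE_Int[OF FE_UNIV[OF HE_FE[OF that]] GE_FE])
  qed
  have E_bound: "(p / 2) ^ K * prob (HE t \<omega>) \<le> prob (HE t \<omega> \<inter> GE t)" if "\<omega> \<in> space M" for t \<omega>
    unfolding GE_def
  proof (rule chain[OF HE_FE[OF that]])
    show "{\<omega> \<in> space M. es ! k \<in> E (t + Suc k * g) \<omega>} \<in> FE {t + Suc k * g}" if "k < K" for k
      by (rule B_FE[OF that])
    show "p \<le> prob {\<omega> \<in> space M. es ! k \<in> E (t + Suc k * g) \<omega>}" if "k < K" for k
      using es_pair[OF that] by auto
  qed
  define \<delta>S where "\<delta>S = c ^ (CARD('n) * L)"
  have S_bound: "\<delta>S * prob (HS t \<omega>) \<le> prob (HS t \<omega> \<inter> GS t)" for t \<omega>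
  proof -
    \<comment> \<open>The selections observed before \<open>t\<close> are glued to those prescribed
      from \<open>t\<close> on, so that the intersection fixes the values on two disjoint index
      rectangles and its probability is a product. The window contributes
      \<open>CARD('n') * L\<close> factors, each at least \<open>c\<close>.\<close>
    define v where "v j = (if snd j < t then X j \<omega> else \<rho> (snd j - t) (fst j))" for j :: "'n \<times> nat"
    let ?J1 = "UNIV \<times> {..<t} :: ('n \<times> nat) set" and ?J2 = "UNIV \<times> {t..<t + L} :: ('n \<times> nat) set"
    have HS: "HS t \<omega> = {\<omega>' \<in> space M. \<forall>j\<in>?J1. X j \<omega>' = v j}"
      by (auto simp: HS_def v_def)
    have "HS t \<omega> \<inter> GS t = {\<omega>' \<in> space M. \<forall>j\<in>?J1 \<union> ?J2. X j \<omega>' = v j}"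
      by (auto simp: HS_def GS_def v_def)
    then have "prob (HS t \<omega> \<inter> GS t) = (\<Prod>j\<in>?J1 \<union> ?J2. prob {\<omega>' \<in> space M. X j \<omega>' = v j})"
      using prob_indep_vars_point[OF indS, of "?J1 \<union> ?J2" v] by simp
    also have "\<dots> = prob (HS t \<omega>) * (\<Prod>j\<in>?J2. prob {\<omega>' \<in> space M. X j \<omega>' = v j})"
      unfolding HS prob_indep_vars_point[OF indS finite_cartesian_product[OF finite_class.finite_UNIV finite_lessThan]]
      by (intro prod.union_disjoint) auto
    finally have eq: "prob (HS t \<omega> \<inter> GS t) =
        prob (HS t \<omega>) * (\<Prod>j\<in>?J2. prob {\<omega>' \<in> space M. X j \<omega>' = v j})" .
    have "(\<Prod>j\<in>?J2. c) \<le> (\<Prod>j\<in>?J2. prob {\<omega>' \<in> space M. X j \<omega>' = v j})"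
    proof (intro prod_mono conjI)
      fix j assume "j \<in> ?J2"
      then obtain i k where j: "j = (i, k)" "t \<le> k" by auto
      have "prob {\<omega>' \<in> space M. X j \<omega>' = v j} = q (\<rho> (k - t) i)"
        using assms(17)[OF \<rho>(1), of i k "k - t"] \<rho>(1)[of "k - t" i] j
        by (simp add: X_def v_def q_def block_rows_def)
      then show "c \<le> prob {\<omega>' \<in> space M. X j \<omega>' = v j}" using c_le[OF \<rho>(2)] by simp
    qed (use c0 in auto)
    then have "\<delta>S \<le> (\<Prod>j\<in>?J2. prob {\<omega>' \<in> space M. X j \<omega>' = v j})"
      by (simp add: \<delta>S_def card_cartesian_product)
    then show ?thesis unfolding eq by (subst mult.commute) (intro mult_left_mono; simp)
  qed
  have GS_FS: "GS t \<in> FS" "HS t \<omega> \<in> FS" for t \<omega>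
    unfolding GS_def HS_def by (intro FS_all; simp)+
  then have HGS_FS: "HS t \<omega> \<inter> GS t \<in> FS" for t \<omega>
    unfolding FS_def by (intro generated_events_Int)
  have split: "prob (A \<inter> B) = prob A * prob B" if "A \<in> FE UNIV" "B \<in> FS" for A B
    using indep_setD[OF indSE that(2,1)] by (simp add: Int_commute mult.commute)

  define \<delta> where "\<delta> = (p / 2) ^ K * \<delta>S"
  have \<delta>0: "0 < \<delta>" using p0 c0 by (simp add: \<delta>_def \<delta>S_def)
  \<comment> \<open>The graph events and the selection events are independent, so the two
    conditional bounds multiply.\<close>
  have G_prob: "\<delta> * prob {\<omega>' \<in> space M. h t \<omega>' = h t \<omega>} \<le> prob ({\<omega>' \<in> space M. h t \<omega>' = h t \<omega>} \<inter> G t)"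
    if "\<omega> \<in> space M" for t \<omega>
  proof -
    have "\<delta> * prob (HE t \<omega> \<inter> HS t \<omega>) = ((p / 2) ^ K * prob (HE t \<omega>)) * (\<delta>S * prob (HS t \<omega>))"
      using split[OF FE_UNIV[OF HE_FE[OF that]] GS_FS(2)] by (simp add: \<delta>_def)
    also have "\<dots> \<le> prob (HE t \<omega> \<inter> GE t) * prob (HS t \<omega> \<inter> GS t)"
      using E_bound[OF that] S_bound c0 by (intro mult_mono) (auto simp: \<delta>S_def)
    also have "\<dots> = prob ((HE t \<omega> \<inter> GE t) \<inter> (HS t \<omega> \<inter> GS t))"
      using split[OF HGE_FE[OF that] HGS_FS] by simp
    also have "(HE t \<omega> \<inter> GE t) \<inter> (HS t \<omega> \<inter> GS t) = (HE t \<omega> \<inter> HS t \<omega>) \<inter> G t"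
      by (auto simp: G_def HE_def)
    finally show ?thesis by (simp add: atom)
  qed
  have atom_ev: "{\<omega>' \<in> space M. h t \<omega>' = h t \<omega>} \<in> events" if "\<omega> \<in> space M" for t \<omega>
    unfolding atom
    by (rule sets.Int[OF subsetD[OF FE_ev FE_UNIV[OF HE_FE[OF that]]] subsetD[OF FS_ev GS_FS(2)]])
  have G_ev: "G t \<in> events" for t
  proof -
    have eq: "G t = {\<omega> \<in> space M. \<forall>k\<in>{..<K}. es ! k \<in> E (t + Suc k * g) \<omega>} \<inter> GS t"
      by (auto simp: G_def GE_def)
    show ?thesis
      unfolding eq by (rule sets.Int[OF subsetD[OF FE_ev GE_FE] subsetD[OF FS_ev GS_FS(1)]])
  qed

  \<comment> \<open>Geometric decay of the mean squared error\<close>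
  have V_int: "integrable M (V t)" for t
    by (rule expectation_finite_history(1)[of "h t" "V t", OF h_fin atom_ev V_hist])
  have V_G: "\<delta> * expectation (V t) \<le> expectation (\<lambda>\<omega>. V t \<omega> * indicator (G t) \<omega>)" for t
    by (rule expectation_finite_history(2)[of "h t" "V t", OF h_fin atom_ev V_hist G_ev V0 G_prob])
  define a where "a t = expectation (V t)" for t
  have step: "a (t + T) \<le> (1 - \<kappa> * \<delta>) * a t" for t
  proof -
    have VG: "integrable M (\<lambda>\<omega>. V t \<omega> * indicator (G t) \<omega>)"
      by (rule integrable_real_mult_indicator[OF G_ev V_int])
    \<comment> \<open>On a good window the error contracts by \<open>1 - \<kappa>\<close>, and on
      any other it does not grow. The gain on \<open>G t\<close> is at least the share
      \<open>\<delta>\<close> of the mean, because \<open>V t\<close> depends on the history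
      only.\<close>
    have "a (t + T) \<le> expectation (\<lambda>\<omega>. V t \<omega> - \<kappa> * (V t \<omega> * indicator (G t) \<omega>))"
      unfolding a_def
    proof (rule integral_mono[OF V_int])
      fix \<omega> assume "\<omega> \<in> space M"
      then show "V (t + T) \<omega> \<le> V t \<omega> - \<kappa> * (V t \<omega> * indicator (G t) \<omega>)"
        using contract[of \<omega> t] decseqD[OF V_dec, of \<omega> t "t + T"]
        by (cases "\<omega> \<in> G t") (auto simp: algebra_simps)
    qed (use VG V_int in auto)
    also have "\<dots> = a t - \<kappa> * expectation (\<lambda>\<omega>. V t \<omega> * indicator (G t) \<omega>)"
      using VG V_int by (simp add: a_def)
    also have "\<dots> \<le> a t - \<kappa> * (\<delta> * a t)"
      using V_G[of t] \<kappa>(1) by (simp add: a_def)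
    finally show ?thesis by (simp add: algebra_simps)
  qed
  have a0: "0 \<le> a t" for t unfolding a_def by (simp add: V0)
  have a_dec: "decseq a"
    unfolding decseq_Suc_iff a_def using V_dec by (auto intro!: integral_mono V_int simp: decseq_Suc_iff)
  obtain \<mu> b where \<mu>: "0 < \<mu>" "\<mu> < 1" "0 < b" "\<And>t. a t \<le> b * \<mu> ^ t"
    by (rule geometric_decay_of_windows[OF a_dec a0 _ _ step]) (use \<kappa>(1) \<delta>0 in \<open>auto simp: T_def\<close>)

  \<comment> \<open>Almost sure convergence\<close>
  have "a \<longlonglongrightarrow> 0"
  proof (rule tendsto_sandwich[of "\<lambda>_. 0" _ _ "\<lambda>t. b * \<mu> ^ t"])
    show "(\<lambda>t. b * \<mu> ^ t) \<longlonglongrightarrow> 0"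
      using \<mu>(1,2) by (intro tendsto_mult_right_zero LIMSEQ_power_zero) auto
  qed (use a0 \<mu>(4) in auto)
  then have "AE \<omega> in M. (\<lambda>t. V t \<omega>) \<longlonglongrightarrow> 0"
    unfolding a_def by (intro AE_tendsto_0_of_decseq_L1 V_int V0 V_dec)
  then have "AE \<omega> in M. \<forall>i. (\<lambda>t. x t i \<omega>) \<longlonglongrightarrow> xstar"
  proof eventually_elim
    case (elim \<omega>)
    show ?case
    proof
      fix i
      have "(norm (x t i \<omega> - xstar))\<^sup>2 \<le> V t \<omega>" for t
        unfolding V_def sq_error_def
        by (rule member_le_sum[of i UNIV "\<lambda>i. (norm (x t i \<omega> - xstar))\<^sup>2"]) auto
      then have "(\<lambda>t. (norm (x t i \<omega> - xstar))\<^sup>2) \<longlonglongrightarrow> 0"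
        by (intro tendsto_sandwich[OF _ _ tendsto_const elim]) auto
      then have "(\<lambda>t. sqrt ((norm (x t i \<omega> - xstar))\<^sup>2)) \<longlonglongrightarrow> sqrt 0" by (rule tendsto_real_sqrt)
      then show "(\<lambda>t. x t i \<omega>) \<longlonglongrightarrow> xstar"
        by (simp add: tendsto_norm_zero_iff LIM_zero_iff)
    qed
  qed
  moreover have "\<forall>t. integrable M (\<lambda>\<omega>. \<Sum>i\<in>UNIV. (norm (x t i \<omega> - xstar))\<^sup>2) \<and>
      expectation (\<lambda>\<omega>. \<Sum>i\<in>UNIV. (norm (x t i \<omega> - xstar))\<^sup>2) \<le> b * \<mu> ^ t"
    using V_int \<mu>(4) by (simp add: a_def V_def[abs_def] sq_error_def)
  ultimately show ?thesis using \<mu>(1-3) by blast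
qed

end
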